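(* Let $h,k\in\{0,1,2\}$ with $h+k\ge1$. The number $u_{\mathsf{Q}^{hk}}(3;n)$ of ways to place three unlabelled nonattacking partial queens $\mathsf{Q}^{hk}$ on the $n\times n$ board is a polynomial in $n$ when $k<2$ and a quasipolynomial of period $2$ when $k=2$, given for all positive integers $n$ by $$\begin{aligned}u_{\mathsf{Q}^{hk}}(3;n)&=\frac16n^6-\frac{3h+2k}{6}n^5+\Big[\frac{3h+2k}{6}+\frac{h(k+1)+(h+1)k}{3}-\frac12+\delta_{h2}+\frac{5\delta_{k2}}{12}\Big]n^4\\&\quad-\Big[\frac{(h+k-1)(3h+2k)}{3}+\frac k6+\frac{2k\delta_{h2}}{3}+\frac{5h\delta_{k2}}{12}\Big]n^3\\&\quad+\Big[\frac{(h+k-1)^2(h+k+2)}{6}+\frac{hk}{3}+\frac k6+\frac{\delta_{k2}}{3}\Big]n^2\\&\quad-\Big[\frac{(h+k-1)k}{3}+\frac{k\delta_{h2}}{3}+\frac{11h\delta_{k2}}{24}\Big]n+\frac{\delta_{k2}}{8}+(-1)^n\frac{\delta_{k2}}{8}\big(hn-1\big).\end{aligned}$$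
   Context: The board is $[n]^2$ with $[n]=\{1,\dots,n\}$. A partial queen $\mathsf{Q}^{hk}$ has basic move set consisting of $h$ vectors from $\{(1,0),(0,1)\}$ and $k$ vectors from $\{(1,1),(1,-1)\}$. A piece at $z_i$ attacks a piece at $z_j$ if $z_j-z_i$ is a multiple of some basic move (so two pieces on the same square attack each other). $u_{\mathsf{Q}^{hk}}(q;n)$ is the number of placements of $q$ unlabelled pairwise nonattacking pieces on $[n]^2$. $\delta_{ij}$ is the Kronecker delta. *)

theory Defs
  imports
    Complex_Main
    "HOL-Library.Multiset"
    "HOL-Library.Product_Plus"
    "HOL-Computational_Algebra.Polynomial"
begin

definition board :: "nat \<Rightarrow> (int \<times> int) set" where
  "board n = {1..int n} \<times> {1..int n}"

text \<open>Only the number of moves of each kind is prescribed, so a pair \<open>(h, k)\<close> may have several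
  basic move sets; statements about the partial queen are meant for each of them.\<close>

definition partial_queen_moves :: "nat \<Rightarrow> nat \<Rightarrow> (int \<times> int) set \<Rightarrow> bool" where
  "partial_queen_moves h k M \<longleftrightarrow>
     (\<exists>A B. A \<subseteq> {(1, 0), (0, 1)} \<and> card A = h \<and>
            B \<subseteq> {(1, 1), (1, -1)} \<and> card B = k \<and> M = A \<union> B)"

text \<open>The multiple may be negative or zero; if there is at least one basic move,
  every square attacks itself.\<close>

definition attacks :: "(int \<times> int) set \<Rightarrow> int \<times> int \<Rightarrow> int \<times> int \<Rightarrow> bool" where
  "attacks M z w \<longleftrightarrow> (\<exists>m\<in>M. \<exists>c. w - z = (c * fst m, c * snd m))"

text \<open>A placement of unlabelled pieces is a finite multiset of squares. That no two pieces share
  a square is not built in; it follows from the pieces being nonattacking.\<close>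

definition nonattacking :: "(int \<times> int) set \<Rightarrow> (int \<times> int) multiset \<Rightarrow> bool" where
  "nonattacking M P \<longleftrightarrow> (\<forall>z \<in># P. \<forall>w \<in># P - {#z#}. \<not> attacks M z w)"

definition num_placements :: "(int \<times> int) set \<Rightarrow> nat \<Rightarrow> nat \<Rightarrow> nat" where
  "num_placements M q n =
     card {P. size P = q \<and> set_mset P \<subseteq> board n \<and> nonattacking M P}"

text \<open>The counting functions have the positive integers as their domain; the value at 0 is
  irrelevant.\<close>

definition is_polynomial :: "(nat \<Rightarrow> real) \<Rightarrow> bool" where
  "is_polynomial f \<longleftrightarrow> (\<exists>p. \<forall>n\<ge>1. f n = poly p (real n))"

definition is_quasipolynomial :: "nat \<Rightarrow> (nat \<Rightarrow> real) \<Rightarrow> bool" where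
  "is_quasipolynomial d f \<longleftrightarrow>
     d \<ge> 1 \<and> (\<exists>p. \<forall>n\<ge>1. f n = poly (p (n mod d)) (real n))"

text \<open>The period of a quasipolynomial is the smallest possible number of constituents.\<close>

definition quasipolynomial_of_period :: "nat \<Rightarrow> (nat \<Rightarrow> real) \<Rightarrow> bool" where
  "quasipolynomial_of_period d f \<longleftrightarrow>
     is_quasipolynomial d f \<and> (\<forall>d'. is_quasipolynomial d' f \<longrightarrow> d \<le> d')"

definition kronecker :: "nat \<Rightarrow> nat \<Rightarrow> real" where
  "kronecker i j = (if i = j then 1 else 0)"

end

theory Submission
  imports Defs
begin

text \<open>Six times the number of placements is the number of ordered triples of pairwise nonattacking
  squares. Write the attack relation as a 0/1 matrix: it is the sum of the matrices \<open>L\<^sub>m\<close> of "being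
  on the same line of direction \<open>m\<close>", minus \<open>\<bar>M\<bar> - 1\<close> times the identity. Expanding the product of
  the three nonattacking conditions leaves three kinds of sums: the line lengths, the products of the
  lengths of two lines through a common square, and the traces of \<open>L\<^sub>p L\<^sub>q L\<^sub>r\<close>, that is, the triangles
  with sides in given directions. The parity of \<open>n\<close> enters through the product of the two diagonal
  lengths and through the triangles with two diagonal sides, whose hypotenuse has even length.\<close>

subsection \<open>Triples avoiding transversal families of lines\<close>

lemma sum_of_bool_eq:
  fixes f :: "'a \<Rightarrow> real"
  assumes "finite B" "x \<in> B"
  shows "(\<Sum>y\<in>B. of_bool (x = y) * f y) = f x" "(\<Sum>y\<in>B. of_bool (y = x) * f y) = f x"
  using assms by (simp_all add: of_bool_def if_distrib if_distribR sum.delta sum.delta' cong: if_cong)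

text \<open>\<open>\<phi> m\<close> labels the lines of direction \<open>m\<close>: points with
  equal labels share such a line. Transversality says that two lines of different directions have at
  most one point of \<open>B\<close> in common.\<close>

locale transversal_lines =
  fixes B :: "'a set" and M :: "'m set" and \<phi> :: "'m \<Rightarrow> 'a \<Rightarrow> 'b"
  assumes finite_B: "finite B" and finite_M: "finite M"
    and transversal: "\<lbrakk>m \<in> M; m' \<in> M; m \<noteq> m'; x \<in> B; y \<in> B; \<phi> m x = \<phi> m y; \<phi> m' x = \<phi> m' y\<rbrakk>
      \<Longrightarrow> x = y"
begin

definition meet :: "'a \<Rightarrow> 'a \<Rightarrow> bool" where
  "meet x y \<longleftrightarrow> (\<exists>m\<in>M. \<phi> m x = \<phi> m y)"

definition aligned :: "'m \<Rightarrow> 'a \<Rightarrow> 'a \<Rightarrow> real" where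
  "aligned m x y = of_bool (\<phi> m x = \<phi> m y)"

definition len :: "'m \<Rightarrow> 'a \<Rightarrow> real" where
  "len m x = (\<Sum>y\<in>B. aligned m x y)"

text \<open>Degenerate triples, in which some of the points coincide, are included.\<close>

definition tri :: "'m \<Rightarrow> 'm \<Rightarrow> 'm \<Rightarrow> real" where
  "tri m1 m2 m3 = (\<Sum>x\<in>B. \<Sum>y\<in>B. \<Sum>z\<in>B. aligned m1 x y * aligned m2 y z * aligned m3 z x)"

lemma aligned_commute: "aligned m x y = aligned m y x"
  by (auto simp: aligned_def)

lemma aligned_refl [simp]: "aligned m x x = 1"
  by (simp add: aligned_def)

lemma tri_rotate: "tri m1 m2 m3 = tri m2 m3 m1"
proof -
  have "tri m1 m2 m3 = (\<Sum>y\<in>B. \<Sum>x\<in>B. \<Sum>z\<in>B. aligned m1 x y * aligned m2 y z * aligned m3 z x)"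
    unfolding tri_def by (rule sum.swap)
  also have "\<dots> = (\<Sum>y\<in>B. \<Sum>z\<in>B. \<Sum>x\<in>B. aligned m1 x y * aligned m2 y z * aligned m3 z x)"
    by (intro sum.cong refl sum.swap)
  finally show ?thesis by (simp add: tri_def mult_ac)
qed

text \<open>Exchanging the names of \<open>x\<close> and \<open>y\<close> traverses the triangle in
  the opposite sense; together with the rotation this generates all six permutations.\<close>

lemma tri_swap: "tri m1 m2 m3 = tri m1 m3 m2"
proof -
  have "tri m1 m2 m3 = (\<Sum>y\<in>B. \<Sum>x\<in>B. \<Sum>z\<in>B. aligned m1 x y * aligned m2 y z * aligned m3 z x)"
    unfolding tri_def by (rule sum.swap)
  also have "\<dots> = tri m1 m3 m2"
    unfolding tri_def
    by (intro sum.cong refl) (metis aligned_commute mult.assoc mult.commute)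
  finally show ?thesis .
qed

lemma tri_perms:
  assumes "tri a b c = v"
  shows "tri a b c = v" "tri a c b = v" "tri b a c = v" "tri b c a = v" "tri c a b = v" "tri c b a = v"
  using assms by (metis tri_rotate tri_swap)+

text \<open>Alignment in one direction is transitive, so the third side is automatic, and
  \<open>y\<close> and \<open>z\<close> range independently over the line through
  \<open>x\<close>.\<close>

lemma tri_same: "tri m m m = (\<Sum>x\<in>B. len m x * len m x)"
proof -
  have "aligned m x y * aligned m y z * aligned m z x = aligned m x y * aligned m x z" for x y z
    by (auto simp: aligned_def)
  then show ?thesis by (simp only: tri_def len_def sum_product)
qed

text \<open>The two sides of direction \<open>m\<close> put all three points on one line. Then
  \<open>x\<close> and \<open>z\<close> are aligned in both directions and coincide, while
  \<open>y\<close> stays free on the line.\<close>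

lemma tri_two:
  assumes "m \<in> M" "m' \<in> M" "m \<noteq> m'"
  shows "tri m m m' = (\<Sum>x\<in>B. len m x)"
proof -
  have "aligned m x y * aligned m y z * aligned m' z x = of_bool (x = z) * aligned m x y"
    if "x \<in> B" "z \<in> B" for x y z
    using transversal[OF assms(1,2,3) that] by (auto simp: aligned_def)
  then have "tri m m m' = (\<Sum>x\<in>B. \<Sum>y\<in>B. \<Sum>z\<in>B. of_bool (x = z) * aligned m x y)"
    unfolding tri_def by (intro sum.cong refl) simp
  also have "\<dots> = (\<Sum>x\<in>B. len m x)"
    unfolding len_def by (intro sum.cong refl) (simp only: sum_of_bool_eq finite_B)
  finally show ?thesis .
qed

definition excess :: real where
  "excess = real (card M) - 1"

definition total_len :: real where
  "total_len = (\<Sum>m\<in>M. \<Sum>x\<in>B. len m x)"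

text \<open>Two distinct points are aligned in at most one direction, whereas a point is aligned with
  itself in all of them; the second term corrects this overcount on the diagonal.\<close>

lemma meet_eq:
  assumes "x \<in> B" "y \<in> B" "M \<noteq> {}"
  shows "of_bool (meet x y) = (\<Sum>m\<in>M. aligned m x y) - excess * of_bool (x = y)"
proof (cases "x = y")
  case True
  then show ?thesis using assms by (auto simp: meet_def excess_def)
next
  case False
  show ?thesis
  proof (cases "meet x y")
    case True
    then obtain m where m: "m \<in> M" "\<phi> m x = \<phi> m y" by (auto simp: meet_def)
    have "aligned m' x y = of_bool (m = m')" if "m' \<in> M" for m'
      using transversal[OF m(1) that] assms m False by (auto simp: aligned_def)
    then have "(\<Sum>m'\<in>M. aligned m' x y) = (\<Sum>m'\<in>M. of_bool (m = m') * 1)"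
      by (intro sum.cong) auto
    also have "\<dots> = 1" by (rule sum_of_bool_eq) (use finite_M m in auto)
    finally show ?thesis using True False by simp
  next
    case no: False
    then have "(\<Sum>m'\<in>M. aligned m' x y) = 0"
      by (auto simp: meet_def aligned_def)
    then show ?thesis using no False by simp
  qed
qed

section \<open>Counting the triples without meeting pairs by expansion\<close>

lemma card_triples_eq_sum:
  "real (card {(x, y, z). x \<in> B \<and> y \<in> B \<and> z \<in> B \<and> \<not> meet x y \<and> \<not> meet y z \<and> \<not> meet z x})
   = (\<Sum>x\<in>B. \<Sum>y\<in>B. \<Sum>z\<in>B.
       (1 - of_bool (meet x y)) * (1 - of_bool (meet y z)) * (1 - of_bool (meet z x)))"
proof -
  let ?P = "\<lambda>(x, y, z). \<not> meet x y \<and> \<not> meet y z \<and> \<not> meet z x"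
  have "{(x, y, z). x \<in> B \<and> y \<in> B \<and> z \<in> B \<and> \<not> meet x y \<and> \<not> meet y z \<and> \<not> meet z x}
      = {t \<in> B \<times> B \<times> B. ?P t}" by auto
  also have "real (card \<dots>) = (\<Sum>t\<in>B \<times> B \<times> B. of_bool (?P t))"
    using finite_B by (simp add: Int_def)
  also have "\<dots> = (\<Sum>x\<in>B. \<Sum>y\<in>B. \<Sum>z\<in>B. of_bool (?P (x, y, z)))"
    by (simp only: sum.cartesian_product split_def fst_conv snd_conv)
  also have "\<dots> = (\<Sum>x\<in>B. \<Sum>y\<in>B. \<Sum>z\<in>B.
       (1 - of_bool (meet x y)) * (1 - of_bool (meet y z)) * (1 - of_bool (meet z x)))"
    by (intro sum.cong refl) auto
  finally show ?thesis .
qed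

context
  assumes nonempty: "M \<noteq> {}"
begin

abbreviation G :: "'a \<Rightarrow> 'a \<Rightarrow> real" where "G x y \<equiv> \<Sum>m\<in>M. aligned m x y"
abbreviation A :: "'a \<Rightarrow> 'a \<Rightarrow> real" where "A x y \<equiv> of_bool (meet x y)"
abbreviation N :: real where "N \<equiv> real (card B)"

lemma A_commute: "A x y = A y x"
  by (simp add: meet_def eq_commute)

lemma sum_G: "(\<Sum>y\<in>B. G x y) = (\<Sum>m\<in>M. len m x)"
  unfolding len_def by (rule sum.swap)

lemma degree:
  assumes "x \<in> B"
  shows "(\<Sum>y\<in>B. A x y) = (\<Sum>m\<in>M. len m x) - excess"
proof -
  have "(\<Sum>y\<in>B. A x y) = (\<Sum>y\<in>B. G x y - of_bool (x = y) * excess)"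
    using assms by (intro sum.cong refl) (subst meet_eq, use nonempty in auto)
  then show ?thesis
    by (simp add: sum_subtractf sum_of_bool_eq finite_B assms sum_G)
qed

lemma sum_degree: "(\<Sum>x\<in>B. \<Sum>y\<in>B. A x y) = total_len - excess * N"
proof -
  have "(\<Sum>x\<in>B. \<Sum>y\<in>B. A x y) = (\<Sum>x\<in>B. (\<Sum>m\<in>M. len m x) - excess)"
    by (intro sum.cong refl degree)
  also have "\<dots> = total_len - excess * N"
    unfolding total_len_def by (simp add: sum_subtractf, subst sum.swap) simp
  finally show ?thesis .
qed

lemma sum_degree_square:
  "(\<Sum>x\<in>B. (\<Sum>y\<in>B. A x y) * (\<Sum>z\<in>B. A x z))
   = (\<Sum>m\<in>M. \<Sum>m'\<in>M. \<Sum>x\<in>B. len m x * len m' x) - 2 * excess * total_len + excess\<^sup>2 * N"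
proof -
  have "(\<Sum>x\<in>B. (\<Sum>y\<in>B. A x y) * (\<Sum>z\<in>B. A x z))
     = (\<Sum>x\<in>B. (\<Sum>m\<in>M. len m x) * (\<Sum>m\<in>M. len m x) - 2 * excess * (\<Sum>m\<in>M. len m x) + excess\<^sup>2)"
    by (intro sum.cong refl) (simp add: degree algebra_simps power2_eq_square)
  also have "\<dots> = (\<Sum>x\<in>B. \<Sum>m\<in>M. \<Sum>m'\<in>M. len m x * len m' x)
      - 2 * excess * (\<Sum>x\<in>B. \<Sum>m\<in>M. len m x) + excess\<^sup>2 * N"
    by (simp only: sum_subtractf sum.distrib sum_distrib_left[symmetric] sum_product) simp
  also have "(\<Sum>x\<in>B. \<Sum>m\<in>M. len m x) = total_len"
    unfolding total_len_def by (rule sum.swap)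
  also have "(\<Sum>x\<in>B. \<Sum>m\<in>M. \<Sum>m'\<in>M. len m x * len m' x)
      = (\<Sum>m\<in>M. \<Sum>x\<in>B. \<Sum>m'\<in>M. len m x * len m' x)" by (rule sum.swap)
  also have "\<dots> = (\<Sum>m\<in>M. \<Sum>m'\<in>M. \<Sum>x\<in>B. len m x * len m' x)"
    by (intro sum.cong refl sum.swap)
  finally show ?thesis .
qed

text \<open>\<open>G\<close> vanishes wherever the 0/1 factor does.\<close>

lemma A_times_G:
  "G x y * A y x = G x y"
proof (cases "meet x y")
  case True
  then show ?thesis using A_commute[of y x] by simp
next
  case False
  then have "G x y = 0" by (auto simp: meet_def aligned_def)
  then show ?thesis by simp
qed

text \<open>Off the diagonal \<open>G\<close> is 0 or 1 and equals its square; on it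
  \<open>G\<close> is \<open>excess + 1\<close>, whose square exceeds it by
  \<open>excess * (excess + 1)\<close>.\<close>

lemma G_square:
  assumes "x \<in> B" "y \<in> B"
  shows "G x y * G y x = G x y + of_bool (x = y) * (excess * (excess + 1))"
proof -
  have "G y x = A y x + excess * of_bool (x = y)"
    using meet_eq[OF assms(2,1) nonempty] by (auto simp: eq_commute)
  then have "G x y * G y x = G x y * A y x + G x y * excess * of_bool (x = y)"
    by (simp add: algebra_simps)
  also have "G x y * A y x = G x y" by (rule A_times_G)
  also have "G x y * excess * of_bool (x = y) = of_bool (x = y) * (excess * (excess + 1))"
    by (auto simp: excess_def)
  finally show ?thesis .
qed

lemma sum_GGG:
  "(\<Sum>x\<in>B. \<Sum>y\<in>B. \<Sum>z\<in>B. G x y * G y z * G z x)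
   = (\<Sum>m1\<in>M. \<Sum>m2\<in>M. \<Sum>m3\<in>M. tri m1 m2 m3)"
proof -
  have triple_product: "sum f M * sum g M * sum h M = (\<Sum>i\<in>M. \<Sum>j\<in>M. \<Sum>k\<in>M. f i * g j * h k)"
    for f g h :: "'m \<Rightarrow> real"
    unfolding mult.assoc sum_product[of g M h M] by (subst sum_product) (simp only: sum_distrib_left)
  \<comment> \<open>Packing points and directions into tuples leaves a single exchange of two
    sums.\<close>
  have "(\<Sum>x\<in>B. \<Sum>y\<in>B. \<Sum>z\<in>B. G x y * G y z * G z x)
    = (\<Sum>t\<in>B\<times>B\<times>B. \<Sum>m\<in>M\<times>M\<times>M. aligned (fst m) (fst t) (fst (snd t)) *
        aligned (fst (snd m)) (fst (snd t)) (snd (snd t)) * aligned (snd (snd m)) (snd (snd t)) (fst t))"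
    by (simp only: triple_product sum.cartesian_product' fst_conv snd_conv)
  also have "\<dots> = (\<Sum>m\<in>M\<times>M\<times>M. \<Sum>t\<in>B\<times>B\<times>B. aligned (fst m) (fst t) (fst (snd t)) *
        aligned (fst (snd m)) (fst (snd t)) (snd (snd t)) * aligned (snd (snd m)) (snd (snd t)) (fst t))"
    by (rule sum.swap)
  also have "\<dots> = (\<Sum>m1\<in>M. \<Sum>m2\<in>M. \<Sum>m3\<in>M. tri m1 m2 m3)"
    by (simp only: tri_def sum.cartesian_product' fst_conv snd_conv)
  finally show ?thesis .
qed

lemma sum_AAA:
  "(\<Sum>x\<in>B. \<Sum>y\<in>B. \<Sum>z\<in>B. A x y * A y z * A z x)
   = (\<Sum>m1\<in>M. \<Sum>m2\<in>M. \<Sum>m3\<in>M. tri m1 m2 m3) - 3 * excess * total_len - excess ^ 3 * N"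
proof -
  let ?c = excess
  have sum_sum_G: "(\<Sum>x\<in>B. \<Sum>y\<in>B. G x y) = total_len"
    unfolding total_len_def by (subst sum_G, rule sum.swap)
  \<comment> \<open>The factors \<open>G\<close> are replaced by \<open>A\<close> one at a time,
    from the last to the first. Each correction carries one diagonal indicator, which collapses its
    triple sum to a double sum.\<close>
  have step: "A x y * A y z * A z x
     = G x y * G y z * G z x - of_bool (z = x) * (?c * (G x y * G y z))
       - of_bool (y = z) * (?c * (G x y * A z x)) - of_bool (x = y) * (?c * (A y z * A z x))"
    if "x \<in> B" "y \<in> B" "z \<in> B" for x y z
  proof -
    have "A x y = G x y - ?c * of_bool (x = y)" "A y z = G y z - ?c * of_bool (y = z)"
      "A z x = G z x - ?c * of_bool (z = x)"
      using meet_eq that nonempty by blast+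
    then show ?thesis by (simp only:) (simp add: algebra_simps)
  qed
  have "(\<Sum>x\<in>B. \<Sum>y\<in>B. \<Sum>z\<in>B. A x y * A y z * A z x)
    = (\<Sum>x\<in>B. \<Sum>y\<in>B. \<Sum>z\<in>B. G x y * G y z * G z x - of_bool (z = x) * (?c * (G x y * G y z))
       - of_bool (y = z) * (?c * (G x y * A z x)) - of_bool (x = y) * (?c * (A y z * A z x)))"
    by (intro sum.cong refl step)
  also have "\<dots> = (\<Sum>x\<in>B. \<Sum>y\<in>B. \<Sum>z\<in>B. G x y * G y z * G z x)
    - (\<Sum>x\<in>B. \<Sum>y\<in>B. \<Sum>z\<in>B. of_bool (z = x) * (?c * (G x y * G y z)))
    - (\<Sum>x\<in>B. \<Sum>y\<in>B. \<Sum>z\<in>B. of_bool (y = z) * (?c * (G x y * A z x)))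
    - (\<Sum>x\<in>B. \<Sum>y\<in>B. \<Sum>z\<in>B. of_bool (x = y) * (?c * (A y z * A z x)))"
    by (simp only: sum_subtractf)
  also have "(\<Sum>x\<in>B. \<Sum>y\<in>B. \<Sum>z\<in>B. of_bool (z = x) * (?c * (G x y * G y z)))
     = (\<Sum>x\<in>B. \<Sum>y\<in>B. ?c * (G x y + of_bool (x = y) * (?c * (?c + 1))))"
    by (intro sum.cong refl) (simp only: sum_of_bool_eq finite_B G_square)
  also have "\<dots> = ?c * ((\<Sum>x\<in>B. \<Sum>y\<in>B. G x y) + (\<Sum>x\<in>B. \<Sum>y\<in>B. of_bool (x = y) * (?c * (?c + 1))))"
    by (simp only: sum_distrib_left[symmetric] sum.distrib)
  also have "\<dots> = ?c * (total_len + ?c * (?c + 1) * N)"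
    by (simp add: sum_sum_G sum_of_bool_eq finite_B)
  also have "(\<Sum>x\<in>B. \<Sum>y\<in>B. \<Sum>z\<in>B. of_bool (y = z) * (?c * (G x y * A z x)))
     = (\<Sum>x\<in>B. \<Sum>y\<in>B. ?c * G x y)"
    by (intro sum.cong refl) (simp only: sum_of_bool_eq finite_B A_times_G)
  also have "\<dots> = ?c * total_len"
    by (simp only: sum_distrib_left[symmetric] sum_sum_G)
  \<comment> \<open>For \<open>x = y\<close> both remaining factors are the same 0/1 entry, so their
    product is that entry.\<close>
  also have "(\<Sum>x\<in>B. \<Sum>y\<in>B. \<Sum>z\<in>B. of_bool (x = y) * (?c * (A y z * A z x)))
     = (\<Sum>x\<in>B. \<Sum>z\<in>B. \<Sum>y\<in>B. of_bool (x = y) * (?c * (A y z * A z x)))"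
    by (intro sum.cong refl sum.swap)
  also have "\<dots> = (\<Sum>x\<in>B. \<Sum>z\<in>B. ?c * A x z)"
    by (intro sum.cong refl, simp only: sum_of_bool_eq finite_B A_commute[of _ x]) (auto simp: A_commute)
  also have "\<dots> = ?c * (total_len - ?c * N)"
    by (simp only: sum_distrib_left[symmetric] sum_degree)
  finally show ?thesis by (simp only: sum_GGG) (simp add: algebra_simps power2_eq_square power3_eq_cube)
qed

text \<open>In the expansion of \<open>(1 - a) * (1 - b) * (1 - c)\<close> each linear term gives
  the sum of the degrees times \<open>N\<close>. Any two factors share a point, so each quadratic
  term gives the sum of the squared degrees. The cubic term is the trace of the cube of the matrix
  \<open>A\<close>.\<close>

theorem card_triples:
  "real (card {(x, y, z). x \<in> B \<and> y \<in> B \<and> z \<in> B \<and> \<not> meet x y \<and> \<not> meet y z \<and> \<not> meet z x})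
   = N ^ 3 + 3 * excess * N\<^sup>2 + (3 * excess\<^sup>2 + excess ^ 3) * N
     - 3 * (N + excess) * (\<Sum>m\<in>M. \<Sum>x\<in>B. len m x)
     + 3 * (\<Sum>m\<in>M. \<Sum>m'\<in>M. \<Sum>x\<in>B. len m x * len m' x)
     - (\<Sum>m1\<in>M. \<Sum>m2\<in>M. \<Sum>m3\<in>M. tri m1 m2 m3)"
proof -
  let ?S2 = "\<Sum>x\<in>B. (\<Sum>y\<in>B. A x y) * (\<Sum>z\<in>B. A x z)"
  let ?S1 = "\<Sum>x\<in>B. \<Sum>y\<in>B. A x y"
  have a: "(\<Sum>x\<in>B. \<Sum>y\<in>B. \<Sum>z\<in>B. A x y) = N * ?S1"
    by (simp add: sum_distrib_left)
  have b: "(\<Sum>x\<in>B. \<Sum>y\<in>B. \<Sum>z\<in>B. A y z) = N * ?S1"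
    by simp
  have c: "(\<Sum>x\<in>B. \<Sum>y\<in>B. \<Sum>z\<in>B. A z x) = N * ?S1"
    by (simp add: A_commute sum_distrib_left)
  have d: "(\<Sum>x\<in>B. \<Sum>y\<in>B. \<Sum>z\<in>B. A x y * A y z) = ?S2"
    by (subst sum.swap) (simp only: sum_product A_commute)
  have e: "(\<Sum>x\<in>B. \<Sum>y\<in>B. \<Sum>z\<in>B. A y z * A z x) = ?S2"
  proof -
    have "(\<Sum>x\<in>B. \<Sum>y\<in>B. \<Sum>z\<in>B. A y z * A z x) = (\<Sum>x\<in>B. \<Sum>z\<in>B. \<Sum>y\<in>B. A y z * A z x)"
      by (intro sum.cong refl sum.swap)
    also have "\<dots> = (\<Sum>z\<in>B. \<Sum>x\<in>B. \<Sum>y\<in>B. A y z * A z x)" by (rule sum.swap)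
    also have "\<dots> = ?S2"
      by (simp only: sum_product A_commute mult.commute)
    finally show ?thesis .
  qed
  have f: "(\<Sum>x\<in>B. \<Sum>y\<in>B. \<Sum>z\<in>B. A x y * A z x) = ?S2"
    by (simp only: sum_product A_commute)
  have "(1 - a) * (1 - b) * (1 - c) = 1 - a - b - c + a * b + b * c + a * c - a * b * c"
    for a b c :: real by (simp add: algebra_simps)
  then have "(\<Sum>x\<in>B. \<Sum>y\<in>B. \<Sum>z\<in>B. (1 - A x y) * (1 - A y z) * (1 - A z x))
     = (\<Sum>x\<in>B. \<Sum>y\<in>B. \<Sum>z\<in>B. 1) - N * ?S1 - N * ?S1 - N * ?S1 + ?S2 + ?S2 + ?S2
       - (\<Sum>x\<in>B. \<Sum>y\<in>B. \<Sum>z\<in>B. A x y * A y z * A z x)"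
    by (simp only: sum_subtractf sum.distrib a b c d e f)
  then show ?thesis
    unfolding card_triples_eq_sum sum_degree sum_degree_square sum_AAA total_len_def[symmetric]
    by (simp add: algebra_simps power2_eq_square power3_eq_cube)
qed

end

end

subsection \<open>Unordered and ordered placements\<close>

text \<open>Reflexivity of \<open>R\<close> forces the three points to be distinct, so every
  multiset counted on the right arises from exactly six ordered triples.\<close>

lemma card_ordered_triples:
  assumes "finite B" and R_refl: "\<And>x. R x x" and R_sym: "\<And>x y. R x y = R y x"
  shows "card {(x, y, z). x \<in> B \<and> y \<in> B \<and> z \<in> B \<and> \<not> R x y \<and> \<not> R y z \<and> \<not> R z x}
    = 6 * card {P. size P = 3 \<and> set_mset P \<subseteq> B \<and> (\<forall>x\<in>#P. \<forall>y\<in>#P - {#x#}. \<not> R x y)}"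
    (is "card ?T = 6 * card ?P")
proof -
  let ?f = "\<lambda>(x, y, z). {#x, y, z#}"
  have distinct: "x \<noteq> y \<and> y \<noteq> z \<and> x \<noteq> z" if "(x, y, z) \<in> ?T" for x y z
    using that R_refl R_sym by auto
  have P_iff: "{#x, y, z#} \<in> ?P \<longleftrightarrow> (x, y, z) \<in> ?T" for x y z
  proof (cases "x \<noteq> y \<and> y \<noteq> z \<and> x \<noteq> z")
    case True
    then show ?thesis using R_sym[of y x] R_sym[of z x] R_sym[of z y] by auto
  next
    case False
    then have "{#x, y, z#} \<notin> ?P" using R_refl by auto
    then show ?thesis using False distinct by blast
  qed
  have P_ex: "\<exists>x y z. P = {#x, y, z#}" if "P \<in> ?P" for P
  proof -
    have "size P = Suc (Suc (Suc 0))" using that by simp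
    then obtain x Q where Q: "P = add_mset x Q" "size Q = Suc (Suc 0)"
      using size_eq_Suc_imp_eq_union[of P] by force
    then obtain y R where R: "Q = add_mset y R" "size R = Suc 0"
      using size_eq_Suc_imp_eq_union[of Q] by force
    then obtain z where "R = {#z#}"
      by (metis size_1_singleton_mset One_nat_def)
    then show ?thesis using Q R by blast
  qed
  have finT: "finite ?T"
    by (rule finite_subset[of _ "B \<times> B \<times> B"]) (use assms in auto)
  have image: "?P = ?f ` ?T"
  proof (intro subset_antisym subsetI)
    fix P assume P: "P \<in> ?P"
    then obtain x y z where xyz: "P = {#x, y, z#}" using P_ex by blast
    then have "(x, y, z) \<in> ?T" using P P_iff by blast
    then show "P \<in> ?f ` ?T" using xyz by (intro image_eqI[of _ _ "(x, y, z)"]) simp_all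
  next
    fix P assume "P \<in> ?f ` ?T"
    then obtain x y z where "(x, y, z) \<in> ?T" "P = {#x, y, z#}" by auto
    then show "P \<in> ?P" using P_iff by blast
  qed
  have fiber: "card {t \<in> ?T. ?f t = P} = 6" if P_mem: "P \<in> ?P" for P
  proof -
    obtain a b c where P: "P = {#a, b, c#}" using P_ex[OF P_mem] by blast
    then have t: "(a, b, c) \<in> ?T" using P_mem P_iff by blast
    then have d: "a \<noteq> b" "b \<noteq> c" "a \<noteq> c" using distinct by blast+
    have "{t \<in> ?T. ?f t = P} = {(a,b,c),(a,c,b),(b,a,c),(b,c,a),(c,a,b),(c,b,a)}"
      (is "_ = ?six")
    proof (intro subset_antisym subsetI)
      fix t assume "t \<in> {t \<in> ?T. ?f t = P}"
      then obtain x y z where xyz: "t = (x, y, z)" "(x, y, z) \<in> ?T" "{#x, y, z#} = P"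
        by (cases t) auto
      then have "set_mset {#x, y, z#} = set_mset {#a, b, c#}" by (simp only: P)
      then have "x \<in> {a, b, c}" "y \<in> {a, b, c}" "z \<in> {a, b, c}" by auto
      with distinct[OF xyz(2)] show "t \<in> ?six" unfolding xyz(1) by blast
    next
      fix t assume "t \<in> ?six"
      then show "t \<in> {t \<in> ?T. ?f t = P}"
        using t R_sym[of b a] R_sym[of c a] R_sym[of c b] by (auto simp: P)
    qed
    then show ?thesis using d by simp
  qed
  have "card ?T = (\<Sum>P\<in>?f ` ?T. card {t \<in> ?T. ?f t = P})"
    unfolding card_eq_sum by (rule sum.image_gen[OF finT])
  also have "\<dots> = (\<Sum>P\<in>?P. card {t \<in> ?T. ?f t = P})"
    by (rule sum.cong[OF image[symmetric] refl])
  also have "\<dots> = (\<Sum>P\<in>?P. 6)"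
    by (intro sum.cong refl fiber)
  finally show ?thesis by simp
qed

section \<open>Queen attacks as a transversal family of lines\<close>

definition cross :: "int \<times> int \<Rightarrow> int \<times> int \<Rightarrow> int" where
  "cross m z = fst m * snd z - snd m * fst z"

definition queen_moves :: "(int \<times> int) set" where
  "queen_moves = {(1, 0), (0, 1), (1, 1), (1, -1)}"

text \<open>\<open>cross m z\<close> is the determinant of \<open>m\<close> and \<open>z\<close>,
  constant along lines of direction \<open>m\<close>. Equal determinants make \<open>w - z\<close> a
  real multiple of \<open>m\<close>; every queen move has a coordinate 1, and the corresponding
  coordinate of \<open>w - z\<close> is then the integer multiplier.\<close>

lemma attacks_iff:
  assumes "M \<subseteq> queen_moves"
  shows "attacks M z w \<longleftrightarrow> (\<exists>m\<in>M. cross m z = cross m w)"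
proof -
  have "(\<exists>c. w - z = (c * fst m, c * snd m)) \<longleftrightarrow> cross m z = cross m w" if "m \<in> queen_moves" for m
  proof -
    obtain a b where m: "m = (a, b)" by fastforce
    obtain z1 z2 w1 w2 where "z = (z1, z2)" "w = (w1, w2)" by fastforce
    then show ?thesis
      using that unfolding m queen_moves_def cross_def
      by (auto simp: algebra_simps intro: exI[of _ "w1 - z1"] exI[of _ "w2 - z2"])
  qed
  then show ?thesis using assms unfolding attacks_def by blast
qed

text \<open>Different queen moves are linearly independent.\<close>

lemma cross_transversal:
  assumes "m \<in> queen_moves" "m' \<in> queen_moves" "m \<noteq> m'"
    and "cross m z = cross m w" "cross m' z = cross m' w"
  shows "z = w"
  using assms by (auto simp: queen_moves_def cross_def prod_eq_iff)

lemma transversal_lines_board: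
  assumes "M \<subseteq> queen_moves"
  shows "transversal_lines (board n) M cross"
proof
  show "finite M" by (rule finite_subset[OF assms]) (simp add: queen_moves_def)
  show "x = y" if "m \<in> M" "m' \<in> M" "m \<noteq> m'" "cross m x = cross m y" "cross m' x = cross m' y"
    for m m' x y using cross_transversal[of m m' x y] that assms by blast
qed (simp add: board_def)

subsection \<open>Line lengths and triangles on the board\<close>

text \<open>Line lengths and triangles depend on the directions named in them and not on the whole
  move set, so those computed for the full queen serve every partial queen.\<close>

interpretation queen: transversal_lines "board n" queen_moves cross for n :: nat
  by (rule transversal_lines_board) simp

lemma sum_board: "(\<Sum>z\<in>board n. f z) = (\<Sum>a\<in>{1..int n}. \<Sum>b\<in>{1..int n}. f (a, b))"
  by (simp add: board_def sum.cartesian_product)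

lemma card_board: "real (card (board n)) = real n ^ 2"
  by (simp add: board_def power2_eq_square)

lemma mem_board: "(a, b) \<in> board n \<longleftrightarrow> a \<in> {1..int n} \<and> b \<in> {1..int n}"
  by (simp add: board_def)

lemma sum_of_bool_point:
  fixes f :: "int \<Rightarrow> real"
  shows "(\<Sum>b\<in>{1..int n}. of_bool (b = t) * f b) = of_bool (t \<in> {1..int n}) * f t"
proof (cases "t \<in> {1..int n}")
  case True
  then show ?thesis by (simp add: sum_of_bool_eq)
next
  case False
  then have "(\<Sum>b\<in>{1..int n}. of_bool (b = t) * f b) = 0"
    by (intro sum.neutral) auto
  then show ?thesis using False by simp
qed

lemma sum_of_bool_shift:
  assumes "\<bar>d\<bar> \<le> int n"
  shows "(\<Sum>a\<in>{1..int n}. of_bool (a + d \<in> {1..int n}) :: real) = real n - \<bar>real_of_int d\<bar>"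
proof -
  have "{1..int n} \<inter> {a. a + d \<in> {1..int n}} = {max 1 (1 - d)..min (int n) (int n - d)}"
    by auto
  then have "(\<Sum>a\<in>{1..int n}. of_bool (a + d \<in> {1..int n}) :: real)
      = real (card {max 1 (1 - d)..min (int n) (int n - d)})"
    by (simp add: Int_def)
  \<comment> \<open>The bound on \<open>d\<close> matters: beyond it the interval is empty, but the
    right-hand side would be negative.\<close>
  also have "\<dots> = real n - \<bar>real_of_int d\<bar>"
    using assms by (cases "d \<ge> 0") auto
  finally show ?thesis .
qed

lemma sum_of_bool_symmetric_shift:
  "(\<Sum>a\<in>{1..int n}. of_bool (a + d \<in> {1..int n} \<and> a - d \<in> {1..int n}) :: real)
   = max 0 (real n - 2 * \<bar>real_of_int d\<bar>)"
proof -
  have "{1..int n} \<inter> {a. a + d \<in> {1..int n} \<and> a - d \<in> {1..int n}} = {1 + \<bar>d\<bar>..int n - \<bar>d\<bar>}"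
    by auto
  then have "(\<Sum>a\<in>{1..int n}. of_bool (a + d \<in> {1..int n} \<and> a - d \<in> {1..int n}) :: real)
      = real (card {1 + \<bar>d\<bar>..int n - \<bar>d\<bar>})"
    by (simp add: Int_def)
  also have "\<dots> = real (nat (int n - 2 * \<bar>d\<bar>))"
    by (simp add: algebra_simps)
  also have "\<dots> = max 0 (real n - 2 * \<bar>real_of_int d\<bar>)"
    by (auto simp: max_def)
  finally show ?thesis .
qed

lemma len_row:
  assumes "z \<in> board n" shows "queen.len n (1, 0) z = real n"
proof -
  have "queen.len n (1, 0) z = (\<Sum>a\<in>{1..int n}. \<Sum>b\<in>{1..int n}. of_bool (b = snd z) * 1)"
    unfolding queen.len_def queen.aligned_def cross_def sum_board
    by (intro sum.cong refl) auto
  also have "\<dots> = real n" using assms by (simp only: sum_of_bool_point) (auto simp: board_def)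
  finally show ?thesis .
qed

lemma len_col:
  assumes "z \<in> board n" shows "queen.len n (0, 1) z = real n"
proof -
  have "queen.len n (0, 1) z = (\<Sum>a\<in>{1..int n}. of_bool (a = fst z) * (\<Sum>b\<in>{1..int n}. 1))"
    unfolding queen.len_def queen.aligned_def cross_def sum_board sum_distrib_left
    by (intro sum.cong refl) auto
  also have "\<dots> = real n" using assms by (simp only: sum_of_bool_point) (auto simp: board_def)
  finally show ?thesis .
qed

lemma len_diag:
  assumes "(p, q) \<in> board n"
  shows "queen.len n (1, 1) (p, q) = real n - \<bar>real_of_int (p - q)\<bar>"
proof -
  have "queen.len n (1, 1) (p, q) = (\<Sum>a\<in>{1..int n}. \<Sum>b\<in>{1..int n}. of_bool (b = a + (q - p)) * 1)"
    unfolding queen.len_def queen.aligned_def cross_def sum_board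
    by (intro sum.cong refl) auto
  also have "\<dots> = (\<Sum>a\<in>{1..int n}. of_bool (a + (q - p) \<in> {1..int n}))"
    unfolding sum_of_bool_point by simp
  also have "\<dots> = real n - \<bar>real_of_int (q - p)\<bar>"
    by (rule sum_of_bool_shift) (use assms in \<open>auto simp: board_def\<close>)
  finally show ?thesis by (simp add: abs_minus_commute)
qed

lemma sum_reflect: "(\<Sum>a\<in>{1..int n}. f (int n + 1 - a)) = (\<Sum>a\<in>{1..int n}. f a)"
  by (rule sum.reindex_bij_witness[of _ "\<lambda>a. int n + 1 - a" "\<lambda>a. int n + 1 - a"]) auto

text \<open>Reflecting the second coordinate exchanges the two diagonal directions.\<close>

lemma len_anti:
  assumes "(p, q) \<in> board n"
  shows "queen.len n (1, -1) (p, q) = real n - \<bar>real_of_int (p + q - int n - 1)\<bar>"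
proof -
  have "queen.len n (1, -1) (p, q) = queen.len n (1, 1) (p, int n + 1 - q)"
    unfolding queen.len_def queen.aligned_def cross_def sum_board
    by (subst (2) sum_reflect[symmetric]) (intro sum.cong refl, auto)
  then show ?thesis using assms by (subst (asm) len_diag) (auto simp: board_def algebra_simps)
qed

section \<open>Sums of the diagonal lengths\<close>

lemma sum_interval_Suc:
  fixes f :: "int \<Rightarrow> real"
  shows "(\<Sum>a\<in>{1..int (Suc n)}. f a) = f (int n + 1) + (\<Sum>a\<in>{1..int n}. f a)"
proof -
  have "{1..int (Suc n)} = insert (int n + 1) {1..int n}" by auto
  then show ?thesis by simp
qed

text \<open>A distance \<open>s > 0\<close> occurs for \<open>n - s\<close> pairs in each of the two
  orders. The induction adds a row and a column, each contributing every \<open>f s\<close> once,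
  and a new corner contributing \<open>f 0\<close>.\<close>

lemma sum_abs_diff:
  fixes f :: "int \<Rightarrow> real"
  shows "(\<Sum>a\<in>{1..int n}. \<Sum>b\<in>{1..int n}. f \<bar>a - b\<bar>) = real n * f 0 + 2 * (\<Sum>s\<in>{1..int n}. (real n - of_int s) * f s)"
proof (induction n)
  case (Suc n)
  have r: "(\<Sum>b\<in>{1..int n}. f \<bar>int n + 1 - b\<bar>) = (\<Sum>s\<in>{1..int n}. f s)"
    by (subst sum_reflect[symmetric]) (intro sum.cong refl, auto)
  have r': "(\<Sum>b\<in>{1..int n}. f \<bar>b - (int n + 1)\<bar>) = (\<Sum>s\<in>{1..int n}. f s)"
    unfolding r[symmetric] by (simp add: abs_minus_commute)
  have "(\<Sum>s\<in>{1..int n}. (real (Suc n) - s) * f s)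
      = (\<Sum>s\<in>{1..int n}. (real n - s) * f s) + (\<Sum>s\<in>{1..int n}. f s)"
    unfolding sum.distrib[symmetric] by (intro sum.cong refl) (simp add: algebra_simps)
  then show ?case using Suc.IH
    by (simp only: sum_interval_Suc sum.distrib r r' diff_self abs_zero) (simp add: algebra_simps)
qed simp

text \<open>Also the sum of the squared lengths of all diagonals of one direction: each square
  counts the length of its own diagonal.\<close>

definition diag_sum :: "nat \<Rightarrow> real" where "diag_sum n = real n * (2 * real n ^ 2 + 1) / 3"

text \<open>The constant \<open>N\<close> is kept apart from the upper limit so that it stays fixed
  during the induction.\<close>

lemma sum_diff_squares:
  "(\<Sum>s\<in>{1..int m}. (N - of_int s) * (N - of_int s))
     = real m * N\<^sup>2 - N * real m * (real m + 1) + real m * (real m + 1) * (2 * real m + 1) / 6"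
  by (induction m)
    (simp, simp only: sum_interval_Suc, simp add: field_simps power2_eq_square)

lemma sum_diff_cubes:
  "(\<Sum>s\<in>{1..int m}. (N - of_int s) * ((N - of_int s) * (N - of_int s)))
     = real m * N ^ 3 - 3 * N\<^sup>2 * real m * (real m + 1) / 2
       + N * real m * (real m + 1) * (2 * real m + 1) / 2 - (real m * (real m + 1) / 2)\<^sup>2"
  by (induction m)
    (simp, simp only: sum_interval_Suc, simp add: field_simps power2_eq_square power3_eq_cube)

lemma sum_diff_mixed:
  "(\<Sum>s\<in>{1..int m}. (N - of_int s) * (N - 2 * of_int s))
     = real m * N\<^sup>2 - 3 * N * real m * (real m + 1) / 2
       + real m * (real m + 1) * (2 * real m + 1) / 3"
  by (induction m)
    (simp, simp only: sum_interval_Suc, simp add: field_simps power2_eq_square)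

lemma sum_len_diag: "(\<Sum>z\<in>board n. queen.len n (1, 1) z) = diag_sum n"
proof -
  have "(\<Sum>z\<in>board n. queen.len n (1, 1) z)
     = (\<Sum>a\<in>{1..int n}. \<Sum>b\<in>{1..int n}. real n - of_int \<bar>a - b\<bar>)"
    unfolding sum_board by (intro sum.cong refl) (simp add: len_diag mem_board)
  also have "\<dots> = diag_sum n"
    unfolding sum_abs_diff[of "\<lambda>s. real n - of_int s"] sum_diff_squares diag_sum_def
    by (simp add: field_simps power2_eq_square)
  finally show ?thesis .
qed

lemma sum_len_diag_square:
  "(\<Sum>z\<in>board n. queen.len n (1, 1) z * queen.len n (1, 1) z) = real n ^ 2 * (real n ^ 2 + 1) / 2"
proof -
  have "(\<Sum>z\<in>board n. queen.len n (1, 1) z * queen.len n (1, 1) z)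
     = (\<Sum>a\<in>{1..int n}. \<Sum>b\<in>{1..int n}. (real n - of_int \<bar>a - b\<bar>) * (real n - of_int \<bar>a - b\<bar>))"
    unfolding sum_board by (intro sum.cong refl) (simp add: len_diag mem_board)
  also have "\<dots> = real n ^ 2 * (real n ^ 2 + 1) / 2"
    unfolding sum_abs_diff[of "\<lambda>s. (real n - of_int s) * (real n - of_int s)"] sum_diff_cubes
    by (simp add: field_simps power2_eq_square power3_eq_cube)
  finally show ?thesis .
qed

lemma len_anti_reflect:
  assumes "a \<in> {1..int n}" "b \<in> {1..int n}"
  shows "queen.len n (1, -1) (a, int n + 1 - b) = queen.len n (1, 1) (a, b)"
  using assms by (subst len_anti, simp add: mem_board, subst len_diag) (auto simp: mem_board algebra_simps)

lemma sum_len_anti: "(\<Sum>z\<in>board n. queen.len n (1, -1) z) = diag_sum n"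
proof -
  have "(\<Sum>z\<in>board n. queen.len n (1, -1) z) = (\<Sum>z\<in>board n. queen.len n (1, 1) z)"
    unfolding sum_board by (subst sum_reflect[symmetric]) (intro sum.cong refl len_anti_reflect)
  then show ?thesis by (simp add: sum_len_diag)
qed

lemma sum_len_anti_square:
  "(\<Sum>z\<in>board n. queen.len n (1, -1) z * queen.len n (1, -1) z) = real n ^ 2 * (real n ^ 2 + 1) / 2"
proof -
  have "(\<Sum>z\<in>board n. queen.len n (1, -1) z * queen.len n (1, -1) z)
     = (\<Sum>z\<in>board n. queen.len n (1, 1) z * queen.len n (1, 1) z)"
    unfolding sum_board
    by (subst sum_reflect[symmetric], intro sum.cong refl, simp only: len_anti_reflect)
  then show ?thesis by (simp add: sum_len_diag_square)
qed

section \<open>Products of the two diagonal lengths\<close>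

text \<open>The two diagonal lengths at \<open>(a, b)\<close> involve
  \<open>\<bar>a - b\<bar> * \<bar>a + b - n - 1\<bar> = \<bar>bump n a - bump n b\<bar>\<close>. Surrounding the board by one
  layer of squares shifts \<open>bump\<close> by the constant \<open>n + 2\<close>, which yields a recursion from
  \<open>n\<close> to \<open>n + 2\<close>.\<close>

definition bump :: "nat \<Rightarrow> int \<Rightarrow> int" where
  "bump n a = a * (int n + 1 - a)"

lemma sum_interval_add_2:
  fixes f :: "int \<Rightarrow> real"
  shows "(\<Sum>a\<in>{1..int (n + 2)}. f a) = f 1 + f (int n + 2) + (\<Sum>a\<in>{1..int n}. f (a + 1))"
proof -
  have "{1..int (n + 2)} = insert 1 (insert (int n + 2) {2..int n + 1})"
    by auto
  moreover have "(\<Sum>a\<in>{2..int n + 1}. f a) = (\<Sum>a\<in>{1..int n}. f (a + 1))"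
    by (rule sum.reindex_bij_witness[of _ "\<lambda>a. a + 1" "\<lambda>a. a - 1"]) auto
  ultimately show ?thesis by simp
qed

lemma sum_bump: "(\<Sum>a\<in>{1..int n}. real_of_int (bump n a)) = real n * (real n + 1) * (real n + 2) / 6"
proof -
  have "(\<Sum>a\<in>{1..int m}. real_of_int a * (N + 1 - of_int a))
     = (N + 1) * real m * (real m + 1) / 2 - real m * (real m + 1) * (2 * real m + 1) / 6"
    for m :: nat and N :: real
    by (induction m) (simp, simp only: sum_interval_Suc, simp add: field_simps)
  from this[where m = n and N = "real n"] show ?thesis by (simp add: bump_def field_simps)
qed

text \<open>The recursion preserves parity, so the parity term is determined by the base cases 0 and
  1.\<close>

lemma sum_abs_bump_diff:
  "(\<Sum>a\<in>{1..int n}. \<Sum>b\<in>{1..int n}. real_of_int \<bar>bump n a - bump n b\<bar>)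
   = (real n ^ 4 - 4 * real n ^ 2) / 12 + (1 - (-1) ^ n) / 8"
proof (induction n rule: induct_nat_012)
  case (ge2 n)
  let ?g = "bump (n + 2)"
  have g: "?g 1 = int n + 2" "?g (int n + 2) = int n + 2" "\<And>a. ?g (a + 1) = bump n a + (int n + 2)"
    by (simp_all add: bump_def algebra_simps)
  have pos: "\<bar>bump n a\<bar> = bump n a" if "a \<in> {1..int n}" for a
    using that by (auto simp: bump_def)
  \<comment> \<open>Both ends have the value \<open>n + 2\<close>, so pairs of ends contribute 0. An
    interior index differs from an end by \<open>bump n a\<close>, and this happens four times: two
    ends, in two orders.\<close>
  have "(\<Sum>a\<in>{1..int (n + 2)}. \<Sum>b\<in>{1..int (n + 2)}. real_of_int \<bar>?g a - ?g b\<bar>)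
     = 4 * (\<Sum>a\<in>{1..int n}. real_of_int \<bar>bump n a\<bar>)
       + (\<Sum>a\<in>{1..int n}. \<Sum>b\<in>{1..int n}. real_of_int \<bar>bump n a - bump n b\<bar>)"
    unfolding sum_interval_add_2 g by (simp add: sum.distrib flip: sum_distrib_left)
  also have "(\<Sum>a\<in>{1..int n}. real_of_int \<bar>bump n a\<bar>) = real n * (real n + 1) * (real n + 2) / 6"
    unfolding sum_bump[symmetric] by (intro sum.cong refl) (simp only: pos)
  also note ge2.IH(1)
  finally show ?case by (simp add: field_simps eval_nat_numeral)
qed (simp_all add: bump_def)

text \<open>The last term is 1/4 for odd \<open>n\<close> and 0 for even \<open>n\<close>.\<close>

definition diag_anti_sum :: "nat \<Rightarrow> real" where
  "diag_anti_sum n = (5 * real n ^ 4 + 4 * real n ^ 2) / 12 + (1 - (-1) ^ n) / 8"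

lemma sum_len_diag_anti:
  "(\<Sum>z\<in>board n. queen.len n (1, 1) z * queen.len n (1, -1) z) = diag_anti_sum n"
proof -
  let ?I = "{1..int n}"
  have bump_sum: "(\<Sum>z\<in>board n. real_of_int \<bar>bump n (fst z) - bump n (snd z)\<bar>)
      = (\<Sum>a\<in>?I. \<Sum>b\<in>?I. real_of_int \<bar>bump n a - bump n b\<bar>)"
    by (simp add: sum_board)
  have "(\<Sum>z\<in>board n. queen.len n (1, 1) z * queen.len n (1, -1) z)
    = (\<Sum>z\<in>board n. real n * queen.len n (1, 1) z + real n * queen.len n (1, -1) z - real n ^ 2
       + of_int \<bar>bump n (fst z) - bump n (snd z)\<bar>)"
  proof (rule sum.cong[OF refl])
    fix z assume "z \<in> board n"
    then obtain a b where z: "z = (a, b)" "(a, b) \<in> board n" by (cases z) auto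
    \<comment> \<open>With \<open>u\<close> and \<open>v\<close> the distances from the two main
      diagonals, this isolates the product \<open>u * v\<close>; the other terms are linear in the
      lengths.\<close>
    have expand: "(r - u) * (r - v) = r * (r - u) + r * (r - v) - r ^ 2 + u * v" for r u v :: real
      by (simp add: algebra_simps power2_eq_square)
    have "\<bar>real_of_int (a - b)\<bar> * \<bar>real_of_int (a + b - int n - 1)\<bar>
        = of_int \<bar>(a - b) * (a + b - int n - 1)\<bar>" by (simp add: abs_mult)
    also have "(a - b) * (a + b - int n - 1) = - (bump n a - bump n b)"
      by (simp add: bump_def algebra_simps)
    finally have "\<bar>real_of_int (a - b)\<bar> * \<bar>real_of_int (a + b - int n - 1)\<bar>
        = of_int \<bar>bump n a - bump n b\<bar>" by simp
    then show "queen.len n (1, 1) z * queen.len n (1, -1) z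
      = real n * queen.len n (1, 1) z + real n * queen.len n (1, -1) z - real n ^ 2
       + of_int \<bar>bump n (fst z) - bump n (snd z)\<bar>"
      unfolding z len_diag[OF z(2)] len_anti[OF z(2)] expand fst_conv snd_conv by simp
  qed
  also have "\<dots> = real n * (\<Sum>z\<in>board n. queen.len n (1, 1) z)
      + real n * (\<Sum>z\<in>board n. queen.len n (1, -1) z) - real n ^ 4
      + (\<Sum>a\<in>?I. \<Sum>b\<in>?I. real_of_int \<bar>bump n a - bump n b\<bar>)"
    unfolding sum.distrib sum_subtractf sum_distrib_left[symmetric] bump_sum sum_constant card_board
    by (simp flip: power_add)
  also have "\<dots> = diag_anti_sum n"
    unfolding diag_anti_sum_def sum_len_diag sum_len_anti sum_abs_bump_diff diag_sum_def
    by (simp add: field_simps eval_nat_numeral)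
  finally show ?thesis .
qed

section \<open>Triangles with three different directions\<close>

text \<open>The right-angled corner of such a triangle is determined by the two ends of its
  hypotenuse, and always lies on the board.\<close>

lemma tri_right:
  assumes "d = (1, 1) \<or> d = (1, -1)"
  shows "queen.tri n d (1, 0) (0, 1) = diag_sum n"
proof -
  have "queen.tri n d (1, 0) (0, 1)
    = (\<Sum>x\<in>board n. \<Sum>y\<in>board n. \<Sum>z\<in>board n. of_bool (z = (fst x, snd y)) * queen.aligned d x y)"
    unfolding queen.tri_def
    by (intro sum.cong refl) (auto simp: queen.aligned_def cross_def prod_eq_iff)
  also have "\<dots> = (\<Sum>x\<in>board n. \<Sum>y\<in>board n. queen.aligned d x y)"
    by (intro sum.cong refl sum_of_bool_eq) (auto simp: board_def)
  also have "\<dots> = diag_sum n"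
    using assms by (auto simp: queen.len_def[symmetric] sum_len_diag sum_len_anti)
  finally show ?thesis .
qed

text \<open>The number of triangles, degenerate ones included, with two diagonal sides and a
  hypotenuse along a row; columns give the same number.\<close>

definition half_sum :: "nat \<Rightarrow> real" where
  "half_sum n = 5 * real n ^ 3 / 12 + real n * (11 - 3 * (-1) ^ n) / 24"

lemma sum_max_diff:
  "(\<Sum>a\<in>{1..int n}. \<Sum>b\<in>{1..int n}. max 0 (real n - 2 * \<bar>of_int (a - b)\<bar>)) = half_sum n"
proof -
  let ?f = "\<lambda>s::int. max 0 (real n - 2 * of_int s)"
  let ?m = "n div 2"
  have "(\<Sum>a\<in>{1..int n}. \<Sum>b\<in>{1..int n}. max 0 (real n - 2 * \<bar>of_int (a - b)\<bar>))
    = (\<Sum>a\<in>{1..int n}. \<Sum>b\<in>{1..int n}. ?f \<bar>a - b\<bar>)" by simp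
  also have "\<dots> = real n * ?f 0 + 2 * (\<Sum>s\<in>{1..int n}. (real n - of_int s) * ?f s)"
    by (rule sum_abs_diff)
  \<comment> \<open>The summand vanishes for \<open>2 * s > n\<close>, so the sum stops at
    \<open>n div 2\<close>, which makes the result depend on parity.\<close>
  also have "(\<Sum>s\<in>{1..int n}. (real n - of_int s) * ?f s)
    = (\<Sum>s\<in>{1..int ?m}. (real n - of_int s) * (real n - 2 * of_int s))"
  proof (rule sum.mono_neutral_cong_right)
    show "\<forall>s\<in>{1..int n} - {1..int ?m}. (real n - of_int s) * ?f s = 0"
    proof
      fix s assume "s \<in> {1..int n} - {1..int ?m}"
      then have "int n < 2 * s" by auto
      then have "real n < 2 * of_int s" by linarith
      then show "(real n - of_int s) * ?f s = 0" by simp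
    qed
  next
    fix s assume "s \<in> {1..int ?m}"
    then have "2 * s \<le> int n" by auto
    then have "2 * real_of_int s \<le> real n" by linarith
    then show "(real n - of_int s) * ?f s = (real n - of_int s) * (real n - 2 * of_int s)" by simp
  qed auto
  also have "real n * ?f 0 + 2 * \<dots> = half_sum n"
  proof (cases "even n")
    case True
    then obtain m where m: "n = 2 * m" by blast
    then have n: "?m = m" "real n = 2 * real m" "(-1 :: real) ^ n = 1" by simp_all
    show ?thesis unfolding sum_diff_mixed half_sum_def n
      by (simp add: field_simps power2_eq_square power3_eq_cube)
  next
    case False
    then obtain m where m: "n = 2 * m + 1" using oddE by blast
    then have n: "?m = m" "real n = 2 * real m + 1" "(-1 :: real) ^ n = - 1" by simp_all
    show ?thesis unfolding sum_diff_mixed half_sum_def n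
      by (simp add: field_simps power2_eq_square power3_eq_cube)
  qed
  finally show ?thesis .
qed

lemma sum_board_of_bool:
  "(\<Sum>z\<in>board n. of_bool (z = t) * (r :: real)) = of_bool (t \<in> board n) * r"
proof (cases "t \<in> board n")
  case True
  then show ?thesis by (simp add: sum_of_bool_eq board_def)
next
  case False
  then have "(\<Sum>z\<in>board n. of_bool (z = t) * r) = 0"
    by (intro sum.neutral) auto
  then show ?thesis using False by simp
qed

text \<open>If the right-angled corner is \<open>(a, b)\<close> and the hypotenuse has second coordinate \<open>b'\<close>, then
  its ends have the first coordinates \<open>a \<plusminus> (b' - b)\<close>; so one counts the \<open>a\<close> for each pair
  \<open>(b, b')\<close>.\<close>

lemma tri_row: "queen.tri n (1, 1) (1, 0) (1, -1) = half_sum n"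
proof -
  let ?I = "{1..int n}"
  \<comment> \<open>Here \<open>x\<close> is the corner, and \<open>z\<close> is the mirror image of
    \<open>y\<close> in the line of squares with first coordinate \<open>fst x\<close>.\<close>
  have "queen.tri n (1, 1) (1, 0) (1, -1)
    = (\<Sum>x\<in>board n. \<Sum>y\<in>board n. \<Sum>z\<in>board n.
        of_bool (z = (2 * fst x - fst y, snd y)) * queen.aligned (1, 1) x y)"
    unfolding queen.tri_def
    by (intro sum.cong refl) (auto simp: queen.aligned_def cross_def prod_eq_iff)
  also have "\<dots> = (\<Sum>a\<in>?I. \<Sum>b\<in>?I. \<Sum>b'\<in>?I. \<Sum>a'\<in>?I.
      of_bool (a' = a + (b' - b)) * of_bool (2 * a - a' \<in> ?I))"
    unfolding sum_board_of_bool unfolding sum_board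
    by (rule sum.cong[OF refl], rule sum.cong[OF refl], subst sum.swap, intro sum.cong refl)
      (auto simp: queen.aligned_def cross_def mem_board)
  also have "\<dots> = (\<Sum>a\<in>?I. \<Sum>b\<in>?I. \<Sum>b'\<in>?I. of_bool (a + (b' - b) \<in> ?I \<and> a - (b' - b) \<in> ?I))"
    unfolding sum_of_bool_point by (intro sum.cong refl) auto
  also have "\<dots> = (\<Sum>b\<in>?I. \<Sum>a\<in>?I. \<Sum>b'\<in>?I. of_bool (a + (b' - b) \<in> ?I \<and> a - (b' - b) \<in> ?I))"
    by (rule sum.swap)
  also have "\<dots> = (\<Sum>b\<in>?I. \<Sum>b'\<in>?I. \<Sum>a\<in>?I. of_bool (a + (b' - b) \<in> ?I \<and> a - (b' - b) \<in> ?I))"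
    by (intro sum.cong refl sum.swap)
  also have "\<dots> = (\<Sum>b\<in>?I. \<Sum>b'\<in>?I. max 0 (real n - 2 * \<bar>of_int (b' - b)\<bar>))"
    by (simp only: sum_of_bool_symmetric_shift)
  also have "\<dots> = half_sum n"
    unfolding sum_max_diff[symmetric] by (rule sum.swap)
  finally show ?thesis .
qed

lemma sum_board_swap: "(\<Sum>z\<in>board n. f (prod.swap z)) = (\<Sum>z\<in>board n. f z)"
  unfolding sum_board by (simp, rule sum.swap)

lemma sum_board_swap3:
  "(\<Sum>x\<in>board n. \<Sum>y\<in>board n. \<Sum>z\<in>board n. F (prod.swap x) (prod.swap y) (prod.swap z))
   = (\<Sum>x\<in>board n. \<Sum>y\<in>board n. \<Sum>z\<in>board n. F x y z)"
  by (simp only: sum_board_swap[where f = "F (prod.swap x) (prod.swap y)" for x y]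
      sum_board_swap[where f = "\<lambda>y. \<Sum>z\<in>board n. F (prod.swap x) y z" for x]
      sum_board_swap[where f = "\<lambda>x. \<Sum>y\<in>board n. \<Sum>z\<in>board n. F x y z"])

text \<open>Transposing the board exchanges rows and columns and preserves both diagonal
  directions.\<close>

lemma tri_col: "queen.tri n (1, 1) (0, 1) (1, -1) = half_sum n"
proof -
  have "queen.tri n (1, 1) (0, 1) (1, -1) = (\<Sum>x\<in>board n. \<Sum>y\<in>board n. \<Sum>z\<in>board n.
      queen.aligned (1, 1) (prod.swap x) (prod.swap y) * queen.aligned (1, 0) (prod.swap y) (prod.swap z)
      * queen.aligned (1, -1) (prod.swap z) (prod.swap x))"
    unfolding queen.tri_def
    by (intro sum.cong refl) (auto simp: queen.aligned_def cross_def prod_eq_iff algebra_simps)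
  also have "\<dots> = queen.tri n (1, 1) (1, 0) (1, -1)"
    unfolding queen.tri_def
    by (rule sum_board_swap3[where F = "\<lambda>x y z. queen.aligned (1, 1) x y * queen.aligned (1, 0) y z
      * queen.aligned (1, -1) z x"])
  finally show ?thesis by (simp add: tri_row)
qed

subsection \<open>The counting formula\<close>

lemma six_num_placements:
  assumes M: "M \<subseteq> queen_moves" "M \<noteq> {}"
  shows "6 * real (num_placements M 3 n)
   = real n ^ 6 + 3 * (real (card M) - 1) * real n ^ 4
     + (3 * (real (card M) - 1)\<^sup>2 + (real (card M) - 1) ^ 3) * real n ^ 2
     - 3 * (real n ^ 2 + (real (card M) - 1)) * (\<Sum>m\<in>M. \<Sum>z\<in>board n. queen.len n m z)
     + 3 * (\<Sum>m\<in>M. \<Sum>m'\<in>M. \<Sum>z\<in>board n. queen.len n m z * queen.len n m' z)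
     - (\<Sum>m1\<in>M. \<Sum>m2\<in>M. \<Sum>m3\<in>M. queen.tri n m1 m2 m3)"
proof -
  interpret lines: transversal_lines "board n" M cross
    using M(1) by (rule transversal_lines_board)
  have meet: "attacks M = lines.meet"
    by (intro ext) (simp add: attacks_iff[OF M(1)] lines.meet_def)
  have attacks_refl: "attacks M z z" for z
    using M(2) unfolding meet lines.meet_def by blast
  have attacks_sym: "attacks M z w = attacks M w z" for z w
    unfolding meet lines.meet_def by metis
  have "6 * real (num_placements M 3 n) = real (6 * num_placements M 3 n)"
    by simp
  also have "6 * num_placements M 3 n = card {(x, y, z). x \<in> board n \<and> y \<in> board n \<and> z \<in> board n \<and>
      \<not> attacks M x y \<and> \<not> attacks M y z \<and> \<not> attacks M z x}"
    unfolding num_placements_def nonattacking_def by (rule card_ordered_triples[OF lines.finite_B attacks_refl attacks_sym, symmetric])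
  moreover have "(real n ^ 2) ^ 3 = real n ^ 6" "(real n ^ 2)\<^sup>2 = real n ^ 4"
    by simp_all
  ultimately show ?thesis
    by (simp only: meet lines.card_triples[OF M(2)] lines.excess_def card_board)
qed

lemma sum_len:
  "(\<Sum>z\<in>board n. queen.len n (1, 0) z) = real n ^ 3"
  "(\<Sum>z\<in>board n. queen.len n (0, 1) z) = real n ^ 3"
  "(\<Sum>z\<in>board n. queen.len n (1, 1) z) = diag_sum n"
  "(\<Sum>z\<in>board n. queen.len n (1, -1) z) = diag_sum n"
  by (simp_all add: len_row len_col sum_len_diag sum_len_anti card_board eval_nat_numeral)

lemma sum_len_product:
  "(\<Sum>z\<in>board n. queen.len n (1, 0) z * queen.len n m z)
     = real n * (\<Sum>z\<in>board n. queen.len n m z)"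
  "(\<Sum>z\<in>board n. queen.len n (0, 1) z * queen.len n m z)
     = real n * (\<Sum>z\<in>board n. queen.len n m z)"
  "(\<Sum>z\<in>board n. queen.len n m z * queen.len n (1, 0) z)
     = real n * (\<Sum>z\<in>board n. queen.len n m z)"
  "(\<Sum>z\<in>board n. queen.len n m z * queen.len n (0, 1) z)
     = real n * (\<Sum>z\<in>board n. queen.len n m z)"
  by (simp_all add: len_row len_col sum_distrib_left mult.commute)

lemma sum_len_anti_diag:
  "(\<Sum>z\<in>board n. queen.len n (1, -1) z * queen.len n (1, 1) z)
   = diag_anti_sum n"
  using sum_len_diag_anti by (simp only: mult.commute)

text \<open>Omitting one of the four directions leaves four sets of three; each is listed in all six
  orders.\<close>

lemmas tri_distinct =
  queen.tri_perms[OF tri_right[of "(1, 1)", simplified]]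
  queen.tri_perms[OF tri_right[of "(1, -1)", simplified]]
  queen.tri_perms[OF tri_row] queen.tri_perms[OF tri_col]

lemma tri_two_equal:
  assumes "m \<in> queen_moves" "m' \<in> queen_moves" "m \<noteq> m'"
  shows "queen.tri n m m m' = (\<Sum>z\<in>board n. queen.len n m z)"
    "queen.tri n m m' m = (\<Sum>z\<in>board n. queen.len n m z)"
    "queen.tri n m' m m = (\<Sum>z\<in>board n. queen.len n m z)"
  by (fact queen.tri_perms[OF queen.tri_two[OF assms]])+

section \<open>Summation over the chosen moves\<close>

lemma subset_pair_cases:
  assumes "A \<subseteq> {a, b}"
  obtains "A = {}" | "A = {a}" | "A = {b}" | "A = {a, b}"
  using assms by blast

context
  fixes A B :: "(int \<times> int) set"
  assumes A: "A \<subseteq> {(1, 0), (0, 1)}" and B: "B \<subseteq> {(1, 1), (1, -1)}"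
begin

lemma sum_len_moves:
  "(\<Sum>m\<in>A \<union> B. \<Sum>z\<in>board n. queen.len n m z)
   = real (card A) * real n ^ 3 + real (card B) * diag_sum n"
  using A B by (elim subset_pair_cases; simp add: sum_len)

text \<open>The terms correspond to ordered pairs of directions: two horizontal or vertical ones, a
  mixed pair, one diagonal direction twice, and the two different diagonals.\<close>

lemma sum_len_product_moves:
  "(\<Sum>m\<in>A \<union> B. \<Sum>m'\<in>A \<union> B. \<Sum>z\<in>board n. queen.len n m z * queen.len n m' z)
   = real (card A) ^ 2 * real n ^ 4 + 2 * real (card A) * real (card B) * (real n * diag_sum n)
     + real (card B) * (real n ^ 2 * (real n ^ 2 + 1) / 2)
     + real (card B) * (real (card B) - 1) * diag_anti_sum n"
proof -
  have 4: "real n * real n ^ 3 = real n ^ 4" by (simp add: eval_nat_numeral)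
  show ?thesis
  using A B by (elim subset_pair_cases; simp add: sum_len_product sum_len
    sum_len_diag_square sum_len_anti_square sum_len_diag_anti sum_len_anti_diag 4)
qed

text \<open>The first two terms have all three directions equal. In the third, two are equal: the
  other one has three positions and \<open>card A + card B - 1\<close> values. The last two have
  distinct directions, in six orders: either both members of \<open>A\<close> and one of
  \<open>B\<close>, or the reverse.\<close>

lemma sum_tri_moves:
  "(\<Sum>m1\<in>A \<union> B. \<Sum>m2\<in>A \<union> B. \<Sum>m3\<in>A \<union> B. queen.tri n m1 m2 m3)
   = real (card A) * real n ^ 4 + real (card B) * (real n ^ 2 * (real n ^ 2 + 1) / 2)
     + 3 * (real (card A) + real (card B) - 1) * (real (card A) * real n ^ 3 + real (card B) * diag_sum n)
     + 6 * real (card B) * kronecker (card A) 2 * diag_sum n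
     + 6 * real (card A) * kronecker (card B) 2 * half_sum n"
proof -
  have 4: "real n * real n ^ 3 = real n ^ 4" by (simp add: eval_nat_numeral)
  show ?thesis
  using A B by (elim subset_pair_cases; simp add: queen.tri_same tri_distinct
    tri_two_equal queen_moves_def sum_len_product sum_len sum_len_diag_square sum_len_anti_square
    kronecker_def 4)
qed

end

text \<open>The sign \<open>(-1) ^ n\<close> is a separate argument \<open>s\<close>, so that for
  each fixed \<open>s\<close> a polynomial in \<open>x\<close> remains.\<close>

abbreviation placements_formula :: "nat \<Rightarrow> nat \<Rightarrow> real \<Rightarrow> real \<Rightarrow> real" where
  "placements_formula h k s x \<equiv>
        1 / 6 * x ^ 6
        - (3 * real h + 2 * real k) / 6 * x ^ 5
        + ((3 * real h + 2 * real k) / 6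
            + (real h * (real k + 1) + (real h + 1) * real k) / 3
            - 1 / 2 + kronecker h 2 + 5 * kronecker k 2 / 12) * x ^ 4
        - ((real h + real k - 1) * (3 * real h + 2 * real k) / 3
            + real k / 6 + 2 * real k * kronecker h 2 / 3
            + 5 * real h * kronecker k 2 / 12) * x ^ 3
        + ((real h + real k - 1) ^ 2 * (real h + real k + 2) / 6
            + real h * real k / 3 + real k / 6 + kronecker k 2 / 3) * x ^ 2
        - ((real h + real k - 1) * real k / 3
            + real k * kronecker h 2 / 3
            + 11 * real h * kronecker k 2 / 24) * x
        + kronecker k 2 / 8
        + s * (kronecker k 2 / 8) * (real h * x - 1)"

lemma num_placements_eq:
  assumes "h + k \<ge> 1" and "partial_queen_moves h k M"
  shows "real (num_placements M 3 n) = placements_formula h k ((-1) ^ n) (real n)"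
proof -
  from assms(2) obtain A B where A: "A \<subseteq> {(1, 0), (0, 1)}" "card A = h"
    and B: "B \<subseteq> {(1, 1), (1, -1)}" "card B = k" and M: "M = A \<union> B"
    by (auto simp: partial_queen_moves_def)
  have M1: "M \<subseteq> queen_moves" using A B M by (auto simp: queen_moves_def)
  have M2: "M \<noteq> {}" using A B M assms(1) by auto
  have card_M: "real (card M) = real h + real k"
    unfolding M A(2)[symmetric] B(2)[symmetric]
    using A(1) B(1) by (elim subset_pair_cases; simp)
  have "card A \<le> card {(1 :: int, 0 :: int), (0, 1)}" "card B \<le> card {(1 :: int, 1 :: int), (1, -1)}"
    by (intro card_mono A(1) B(1), simp)+
  then have "h \<in> {0, 1, 2}" "k \<in> {0, 1, 2}" unfolding A B by auto
  \<comment> \<open>What is left is a polynomial identity in \<open>n\<close> and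
    \<open>(-1) ^ n\<close> for each of the nine pairs \<open>(h, k)\<close>.\<close>
  then have "6 * real (num_placements M 3 n) = 6 * placements_formula h k ((-1) ^ n) (real n)"
    unfolding six_num_placements[OF M1 M2] card_M
    unfolding M sum_len_moves[OF A(1) B(1)] sum_len_product_moves[OF A(1) B(1)]
      sum_tri_moves[OF A(1) B(1)] A(2) B(2)
      diag_sum_def half_sum_def diag_anti_sum_def
    by (elim insertE emptyE; simp add: kronecker_def; simp add: field_simps eval_nat_numeral)
  then show ?thesis by simp
qed

section \<open>Polynomial constituents and the minimal period\<close>

lemma ex_poly_placements_formula: "\<exists>p. \<forall>x. poly p x = placements_formula h k s x"
proof -
  have "\<exists>p. \<forall>x. poly p x = c6 * x ^ 6 - c5 * x ^ 5 + c4 * x ^ 4 - c3 * x ^ 3 + c2 * x ^ 2 - c1 * x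
      + c0 + a * (b * x - 1)" for a b c0 c1 c2 c3 c4 c5 c6 :: real
    by (rule exI[of _ "[:c0 - a, a * b - c1, c2, - c3, c4, - c5, c6:]"])
      (simp add: algebra_simps eval_nat_numeral)
  then show ?thesis by blast
qed

lemma poly_eq_if_agree_infinite:
  fixes p q :: "real poly"
  assumes "infinite X" and "\<And>n::nat. n \<in> X \<Longrightarrow> poly p (real n) = poly q (real n)"
  shows "p = q"
proof (rule ccontr)
  assume "p \<noteq> q"
  then have "finite {x. poly (p - q) x = 0}"
    by (intro poly_roots_finite) simp
  moreover have "real ` X \<subseteq> {x. poly (p - q) x = 0}"
    using assms(2) by auto
  ultimately have "finite (real ` X)" by (rule rev_finite_subset)
  then show False using assms(1) by (simp add: finite_image_iff)
qed

theorem theorem4p2: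
  fixes h k :: nat and M :: "(int \<times> int) set"
  assumes "h \<in> {0, 1, 2}" and "k \<in> {0, 1, 2}" and "h + k \<ge> 1"
    and "partial_queen_moves h k M"
  shows "(k < 2 \<longrightarrow> is_polynomial (\<lambda>n. real (num_placements M 3 n))) \<and>
    (k = 2 \<longrightarrow> quasipolynomial_of_period 2 (\<lambda>n. real (num_placements M 3 n))) \<and>
    (\<forall>n::nat. n \<ge> 1 \<longrightarrow>
      real (num_placements M 3 n) =
        1 / 6 * real n ^ 6
        - (3 * real h + 2 * real k) / 6 * real n ^ 5
        + ((3 * real h + 2 * real k) / 6
            + (real h * (real k + 1) + (real h + 1) * real k) / 3
            - 1 / 2 + kronecker h 2 + 5 * kronecker k 2 / 12) * real n ^ 4
        - ((real h + real k - 1) * (3 * real h + 2 * real k) / 3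
            + real k / 6 + 2 * real k * kronecker h 2 / 3
            + 5 * real h * kronecker k 2 / 12) * real n ^ 3
        + ((real h + real k - 1) ^ 2 * (real h + real k + 2) / 6
            + real h * real k / 3 + real k / 6 + kronecker k 2 / 3) * real n ^ 2
        - ((real h + real k - 1) * real k / 3
            + real k * kronecker h 2 / 3
            + 11 * real h * kronecker k 2 / 24) * real n
        + kronecker k 2 / 8
        + (-1) ^ n * (kronecker k 2 / 8) * (real h * real n - 1))"
proof (intro conjI impI allI)
  note formula = num_placements_eq[OF assms(3,4)]
  obtain P where P: "\<And>s x. poly (P s) x = placements_formula h k s x"
    using ex_poly_placements_formula[of h k] by metis
  have P_eq: "real (num_placements M 3 n) = poly (P ((-1) ^ n)) (real n)" for n
    unfolding P by (rule formula)
  show "is_polynomial (\<lambda>n. real (num_placements M 3 n))" if "k < 2"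
  proof -
    \<comment> \<open>For \<open>k < 2\<close> the sign is multiplied by 0, so any value of it, here
      0, yields the same polynomial.\<close>
    have "poly (P ((-1) ^ n)) (real n) = poly (P 0) (real n)" for n
      using that unfolding P by (simp add: kronecker_def)
    then show ?thesis unfolding is_polynomial_def P_eq by metis
  qed
  show "quasipolynomial_of_period 2 (\<lambda>n. real (num_placements M 3 n))" if k: "k = 2"
    unfolding quasipolynomial_of_period_def
  proof (intro conjI allI impI)
    have "(-1 :: real) ^ n = (-1) ^ (n mod 2)" for n :: nat
      by (cases "even n") (simp_all add: odd_iff_mod_2_eq_one)
    then show "is_quasipolynomial 2 (\<lambda>n. real (num_placements M 3 n))"
      unfolding is_quasipolynomial_def P_eq
      by (intro conjI exI[of _ "\<lambda>r. P ((-1) ^ r)"]) auto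
    fix d assume d: "is_quasipolynomial d (\<lambda>n. real (num_placements M 3 n))"
    show "2 \<le> d"
    proof (rule ccontr)
      assume "\<not> 2 \<le> d"
      with d obtain p where "\<And>n. n \<ge> 1 \<Longrightarrow> real (num_placements M 3 n) = poly (p (n mod 1)) (real n)"
        unfolding is_quasipolynomial_def by (metis One_nat_def Suc_1 le_antisym not_less_eq_eq)
      then have p: "poly (P ((-1) ^ n)) (real n) = poly (p 0) (real n)" if "n \<ge> 1" for n
        using that by (simp add: P_eq)
      have "\<exists>n>m. n \<ge> 1 \<and> even n" "\<exists>n>m. n \<ge> 1 \<and> odd n" for m :: nat
        by (rule exI[of _ "2 * m + 2"], simp) (rule exI[of _ "2 * m + 1"], simp)
      then have inf: "infinite {n::nat. n \<ge> 1 \<and> even n}" "infinite {n::nat. n \<ge> 1 \<and> odd n}"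
        unfolding infinite_nat_iff_unbounded by simp_all
      \<comment> \<open>A single polynomial would agree with one constituent at infinitely many even
        \<open>n\<close> and with the other at infinitely many odd \<open>n\<close>.\<close>
      have "P 1 = p 0"
        by (rule poly_eq_if_agree_infinite[OF inf(1)]) (use p in force)
      moreover have "P (-1) = p 0"
        by (rule poly_eq_if_agree_infinite[OF inf(2)]) (use p in force)
      \<comment> \<open>The constant terms differ: \<open>1/8 - 1/8 = 0\<close> for the sign 1 and
        \<open>1/8 + 1/8 = 1/4\<close> for the sign -1.\<close>
      ultimately have "poly (P 1) 0 = poly (P (-1)) 0" by simp
      then show False unfolding P by (simp add: k kronecker_def)
    qed
  qed
  show "real (num_placements M 3 n) = placements_formula h k ((-1) ^ n) (real n)" for n
    by (rule formula)
qed

end
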